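(* Let $H_1$ and $H_2$ be Hilbert spaces and let $Z$ be a Banach space with property $\beta$. Then the pair $(H_1\times H_2,Z)$ has the Bishop-Phelps-Bollobás point property for bilinear mappings.
   Context: All spaces are over the same scalar field $\mathbb{K}$, which is $\mathbb{R}$ or $\mathbb{C}$. $S_X$ and $B_X$ are the unit sphere and closed unit ball of $X$. A Banach space $Z$ has property $\beta$ (with constant $0\le\rho<1$) if there are sets $\{z_i:i\in I\}\subset S_Z$ and $\{z_i^*:i\in I\}\subset S_{Z^*}$ such that (i) $z_i^*(z_i)=1$ for all $i\in I$; (ii) $|z_i^*(z_j)|\le\rho<1$ for all $i,j\in I$ with $i\neq j$; (iii) $\|z\|=\sup_{i\in I}|z_i^*(z)|$ for all $z\in Z$. For Banach spaces $X,Y,Z$, $B(X\times Y,Z)$ is the Banach space of bounded bilinear mappings from $X\times Y$ into $Z$ with norm $\|B\|=\sup\{\|B(x,y)\|:x\in B_X,\,y\in B_Y\}$. The pair $(X\times Y,Z)$ has the Bishop-Phelps-Bollobás point property (BPBpp) for bilinear mappings if for every $\varepsilon>0$ there exists $\eta(\varepsilon)>0$ such that whenever $B\in B(X\times Y,Z)$ with $\|B\|=1$ and $(x_0,y_0)\in S_X\times S_Y$ satisfy $\|B(x_0,y_0)\|>1-\eta(\varepsilon)$, there exists $A\in B(X\times Y,Z)$ with $\|A\|=1$ such that $\|A(x_0,y_0)\|=1$ and $\|A-B\|<\varepsilon$. *)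

theory Defs
  imports "HOL-Analysis.Analysis"
begin

text \<open>
  The scalar field is \<open>\<real>\<close> or \<open>\<complex>\<close>, treated uniformly: \<open>to_complex\<close> is an isometric field embedding
  fixing the reals, and its image is either the real line or the whole complex plane.
\<close>

class real_or_complex = real_normed_field +
  fixes to_complex :: "'a \<Rightarrow> complex"
  assumes to_complex_add: "to_complex (a + b) = to_complex a + to_complex b"
    and to_complex_mult: "to_complex (a * b) = to_complex a * to_complex b"
    and to_complex_scaleR_one: "to_complex (r *\<^sub>R 1) = complex_of_real r"
    and norm_to_complex: "cmod (to_complex a) = norm a"
    and range_to_complex: "range to_complex = \<real> \<or> range to_complex = UNIV"

instantiation real :: real_or_complex
begin
definition "to_complex = complex_of_real"
instance
  by standard (auto simp: to_complex_real_def Reals_def)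
end

instantiation complex :: real_or_complex
begin
definition "to_complex = (\<lambda>z::complex. z)"
instance
  by standard (auto simp: to_complex_complex_def scaleR_conv_of_real)
end

text \<open>
  Libraries provide normed spaces over \<open>\<real>\<close> only.  A normed space over the scalar field \<open>'k\<close> is a
  real normed space with a \<open>'k\<close>-scalar multiplication extending the real one.
\<close>

locale normed_space_over = vector_space smul
  for smul :: "'k::real_or_complex \<Rightarrow> 'a::real_normed_vector \<Rightarrow> 'a" +
  assumes scale_of_real: "smul (of_real r) x = r *\<^sub>R x"
    and norm_scale: "norm (smul c x) = norm c * norm x"

locale banach_space_over = normed_space_over smul
  for smul :: "'k::real_or_complex \<Rightarrow> 'a::banach \<Rightarrow> 'a"

text \<open>The inner product is linear in its first argument; completeness is part of \<open>banach_space_over\<close>.\<close>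

locale hilbert_space_over = banach_space_over smul
  for smul :: "'k::real_or_complex \<Rightarrow> 'a::banach \<Rightarrow> 'a" +
  fixes ip :: "'a \<Rightarrow> 'a \<Rightarrow> 'k"
  assumes ip_add_left: "ip (x + y) z = ip x z + ip y z"
    and ip_scale_left: "ip (smul c x) y = c * ip x y"
    and ip_commute: "to_complex (ip y x) = cnj (to_complex (ip x y))"
    and ip_self: "ip x x = of_real ((norm x)\<^sup>2)"

lemma hilbert_space_over_real:
  "hilbert_space_over (scaleR :: real \<Rightarrow> 'a::{real_inner,banach} \<Rightarrow> 'a) inner"
  by unfold_locales
    (auto simp: algebra_simps to_complex_real_def inner_commute power2_norm_eq_inner)

lemma hilbert_space_over_complex:
  "hilbert_space_over ((*) :: complex \<Rightarrow> complex \<Rightarrow> complex) (\<lambda>x y. x * cnj y)"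
  by unfold_locales
    (auto simp: algebra_simps to_complex_complex_def scaleR_conv_of_real norm_mult
      complex_norm_square simp flip: of_real_power)

definition dual_sphere :: "('k::real_or_complex \<Rightarrow> 'z::real_normed_vector \<Rightarrow> 'z) \<Rightarrow> ('z \<Rightarrow> 'k) set" where
  "dual_sphere smul =
    {f. bounded_linear f \<and> (\<forall>c z. f (smul c z) = c * f z) \<and> onorm f = 1}"

text \<open>
  The supremum is taken in \<open>[0, \<infinity>]\<close>, so that it is \<open>0\<close> for an empty index set
  (which can only occur for the zero space).
\<close>

definition property_beta ::
  "('k::real_or_complex \<Rightarrow> 'z::real_normed_vector \<Rightarrow> 'z) \<Rightarrow> real \<Rightarrow>
    'i set \<Rightarrow> ('i \<Rightarrow> 'z) \<Rightarrow> ('i \<Rightarrow> 'z \<Rightarrow> 'k) \<Rightarrow> bool" where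
  "property_beta smul \<rho> I z zs \<longleftrightarrow>
    0 \<le> \<rho> \<and> \<rho> < 1 \<and>
    z ` I \<subseteq> sphere 0 1 \<and> zs ` I \<subseteq> dual_sphere smul \<and>
    (\<forall>i\<in>I. zs i (z i) = 1) \<and>
    (\<forall>i\<in>I. \<forall>j\<in>I. i \<noteq> j \<longrightarrow> norm (zs i (z j)) \<le> \<rho>) \<and>
    (\<forall>v. ennreal (norm v) = (SUP i\<in>I. ennreal (norm (zs i v))))"

definition bounded_bilinear_over ::
  "('k::real_or_complex \<Rightarrow> 'x::real_normed_vector \<Rightarrow> 'x) \<Rightarrow> ('k \<Rightarrow> 'y::real_normed_vector \<Rightarrow> 'y) \<Rightarrow>
    ('k \<Rightarrow> 'z::real_normed_vector \<Rightarrow> 'z) \<Rightarrow> ('x \<Rightarrow> 'y \<Rightarrow> 'z) \<Rightarrow> bool" where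
  "bounded_bilinear_over smulX smulY smulZ B \<longleftrightarrow>
    bounded_bilinear B \<and>
    (\<forall>c x y. B (smulX c x) y = smulZ c (B x y)) \<and>
    (\<forall>c x y. B x (smulY c y) = smulZ c (B x y))"

definition bilinear_norm ::
  "('x::real_normed_vector \<Rightarrow> 'y::real_normed_vector \<Rightarrow> 'z::real_normed_vector) \<Rightarrow> real" where
  "bilinear_norm B = (SUP (x, y) \<in> cball 0 1 \<times> cball 0 1. norm (B x y))"

definition BPBpp_bilinear ::
  "('k::real_or_complex \<Rightarrow> 'x::real_normed_vector \<Rightarrow> 'x) \<Rightarrow> ('k \<Rightarrow> 'y::real_normed_vector \<Rightarrow> 'y) \<Rightarrow>
    ('k \<Rightarrow> 'z::real_normed_vector \<Rightarrow> 'z) \<Rightarrow> bool" where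
  "BPBpp_bilinear smulX smulY smulZ \<longleftrightarrow>
    (\<forall>\<epsilon>>0. \<exists>\<eta>>0. \<forall>B x0 y0.
      bounded_bilinear_over smulX smulY smulZ B \<longrightarrow> bilinear_norm B = 1 \<longrightarrow>
      x0 \<in> sphere 0 1 \<longrightarrow> y0 \<in> sphere 0 1 \<longrightarrow> norm (B x0 y0) > 1 - \<eta> \<longrightarrow>
      (\<exists>A. bounded_bilinear_over smulX smulY smulZ A \<and> bilinear_norm A = 1 \<and>
        norm (A x0 y0) = 1 \<and> bilinear_norm (\<lambda>x y. A x y - B x y) < \<epsilon>))"

end

theory Submission
  imports Defs
begin

text \<open>
  Everything is explicit.  Let \<open>x0\<close>, \<open>y0\<close> be unit vectors and let \<open>b\<close> be a bilinear form on
  \<open>H1 \<times> H2\<close> of norm at most \<open>1\<close>.  Relative to the decompositions of \<open>H1\<close> and \<open>H2\<close> into the lines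
  through \<open>x0\<close>, \<open>y0\<close> and their orthogonal complements, \<open>b\<close> is a two by two block matrix with corner
  entry \<open>\<beta> = b x0 y0\<close>.  The first row and the first column are functionals of norm at most \<open>1\<close>, so
  when \<open>\<beta>\<close> has modulus close to \<open>1\<close> their parts off the corner are small
  (\<open>norm_functional_orthogonal_le\<close>).  Erasing these two parts and replacing \<open>\<beta>\<close> by \<open>sgn \<beta>\<close> thus
  changes \<open>b\<close> only a little, and the resulting block diagonal form has norm \<open>1\<close>, attained at
  \<open>(x0, y0)\<close> (\<open>norm_attaining_form_near\<close>).

  For values in \<open>Z\<close>, pick an index \<open>i\<close> for which \<open>zs i (B x0 y0)\<close> almost has the norm of \<open>B x0 y0\<close>,
  and let \<open>F\<close> be the form just obtained from \<open>zs i \<circ> B\<close>.  Moving \<open>B\<close> in the direction \<open>z i\<close> only,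
  one can turn its \<open>i\<close>-th coordinate into \<open>(1 + \<delta>) F\<close>.  The other coordinates move by at most \<open>\<rho>\<close>
  times as much, so for \<open>F\<close> sufficiently close to \<open>zs i \<circ> B\<close> they stay below \<open>1 + \<delta>\<close>: the
  \<open>i\<close>-th coordinate decides the norm, which is attained at \<open>(x0, y0)\<close>.  Dividing by \<open>1 + \<delta>\<close>
  gives the required map (\<open>property_beta_lift\<close>).  The tolerance within which the form has to be
  approximated depends only on \<open>\<epsilon>\<close> and \<open>\<rho>\<close>, so one \<open>\<eta>\<close> serves all \<open>B\<close>, \<open>x0\<close>, \<open>y0\<close> and \<open>i\<close>.
\<close>

section \<open>Bounded bilinear maps and their norm\<close>

lemma normed_space_over_mult: "normed_space_over ((*) :: 'k::real_or_complex \<Rightarrow> 'k \<Rightarrow> 'k)"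
  by unfold_locales (auto simp: algebra_simps scaleR_conv_of_real norm_mult)

lemma (in normed_space_over) scale_scaleR: "smul c (r *\<^sub>R x) = r *\<^sub>R smul c x"
  by (metis scale_left_commute scale_of_real)

lemma bounded_bilinear_overI:
  assumes "normed_space_over smulX" "normed_space_over smulY" "normed_space_over smulZ"
    and addl: "\<And>x x' y. B (x + x') y = B x y + B x' y"
    and addr: "\<And>x y y'. B x (y + y') = B x y + B x y'"
    and scl: "\<And>c x y. B (smulX c x) y = smulZ c (B x y)"
    and scr: "\<And>c x y. B x (smulY c y) = smulZ c (B x y)"
    and bound: "\<And>x y. norm (B x y) \<le> C * (norm x * norm y)"
  shows "bounded_bilinear_over smulX smulY smulZ B"
proof -
  interpret X: normed_space_over smulX by fact
  interpret Y: normed_space_over smulY by fact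
  interpret Z: normed_space_over smulZ by fact
  have "bounded_bilinear B"
  proof
    show "\<exists>K. \<forall>a b. norm (B a b) \<le> norm a * norm b * K"
      using bound by (metis mult.commute)
  qed (auto simp: addl addr scl scr simp flip: X.scale_of_real Y.scale_of_real Z.scale_of_real)
  then show ?thesis
    by (simp add: bounded_bilinear_over_def scl scr)
qed

lemma norm_le_bilinear_norm:
  assumes "bounded_bilinear B"
  shows "norm (B x y) \<le> bilinear_norm B * (norm x * norm y)"
proof -
  interpret bounded_bilinear B by fact
  obtain K where K: "\<And>a b. norm (B a b) \<le> norm a * norm b * K" and "K > 0"
    using pos_bounded by blast
  have le: "norm (B a b) \<le> bilinear_norm B" if "norm a \<le> 1" "norm b \<le> 1" for a b
  proof -
    have "norm (B p q) \<le> K" if "norm p \<le> 1" "norm q \<le> 1" for p q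
    proof -
      have "norm p * norm q * K \<le> 1 * 1 * K"
        using that \<open>K > 0\<close> by (intro mult_mono) auto
      then show ?thesis using K[of p q] by simp
    qed
    then have "bdd_above ((\<lambda>(x, y). norm (B x y)) ` (cball 0 1 \<times> cball 0 1))"
      by (intro bdd_aboveI[of _ K]) auto
    from cSUP_upper[OF _ this, of "(a, b)"] that show ?thesis
      by (simp add: bilinear_norm_def)
  qed
  show ?thesis
  proof (cases "x = 0 \<or> y = 0")
    case True
    then show ?thesis by (auto simp: zero_left zero_right)
  next
    case False
    have "norm (B (sgn x) (sgn y)) \<le> bilinear_norm B"
      by (rule le) (auto simp: norm_sgn)
    moreover have "norm (B (sgn x) (sgn y)) = norm (B x y) / (norm x * norm y)"
      using False by (simp add: sgn_div_norm scaleR_left scaleR_right field_simps)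
    ultimately show ?thesis
      using False by (simp add: field_simps)
  qed
qed

lemma bilinear_norm_le:
  assumes "C \<ge> 0" and bound: "\<And>x y. norm (B x y) \<le> C * (norm x * norm y)"
  shows "bilinear_norm B \<le> C"
proof -
  have "norm (B x y) \<le> C" if "norm x \<le> 1" "norm y \<le> 1" for x y
  proof -
    have "C * (norm x * norm y) \<le> C * (1 * 1)"
      using that \<open>C \<ge> 0\<close> by (intro mult_left_mono mult_mono) auto
    then show ?thesis using bound[of x y] by simp
  qed
  then show ?thesis
    unfolding bilinear_norm_def by (intro cSUP_least) auto
qed

section \<open>Orthogonal decomposition in a Hilbert space\<close>

lemma to_complex_diff:
  "to_complex (a - b) = to_complex a - to_complex (b :: 'k::real_or_complex)"
  using to_complex_add[of "a - b" b] by simp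

lemma to_complex_eq_iff: "to_complex a = to_complex b \<longleftrightarrow> a = (b :: 'k::real_or_complex)"
  using norm_to_complex[of "a - b"] by (auto simp: to_complex_diff)

context hilbert_space_over
begin

lemma ip_add_right: "ip x (y + z) = ip x y + ip x z"
proof -
  have "to_complex (ip x (y + z)) = to_complex (ip x y + ip x z)"
    by (simp add: ip_commute[of x] ip_add_left to_complex_add)
  then show ?thesis by (simp add: to_complex_eq_iff)
qed

lemma norm_ip_commute: "norm (ip y x) = norm (ip x y)"
  using ip_commute[of y x] by (metis complex_mod_cnj norm_to_complex)

lemma Pythagoras:
  assumes "ip x y = 0"
  shows "(norm (x + y))\<^sup>2 = (norm x)\<^sup>2 + (norm y)\<^sup>2"
proof -
  have "ip y x = 0"
    using norm_ip_commute[of y x] assms by simp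
  then have "ip (x + y) (x + y) = ip x x + ip y y"
    using assms by (simp add: ip_add_left ip_add_right)
  then have "(of_real ((norm (x + y))\<^sup>2) :: 'k) = of_real ((norm x)\<^sup>2 + (norm y)\<^sup>2)"
    by (simp only: ip_self of_real_add)
  then show ?thesis by (simp only: of_real_eq_iff)
qed

definition orth_part :: "'a \<Rightarrow> 'a \<Rightarrow> 'a" where
  "orth_part u x = x - smul (ip x u) u"

lemma orth_part_add: "orth_part u (x + y) = orth_part u x + orth_part u y"
  by (simp add: orth_part_def ip_add_left scale_left_distrib)

lemma orth_part_scale: "orth_part u (smul c x) = smul c (orth_part u x)"
  by (simp add: orth_part_def ip_scale_left scale_right_diff_distrib)

lemma orth_part_decomp: "x = smul (ip x u) u + orth_part u x"
  by (simp add: orth_part_def)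

context
  fixes u :: 'a
  assumes unit: "norm u = 1"
begin

lemma ip_unit: "ip u u = 1"
  by (simp add: ip_self unit)

lemma orth_part_self: "orth_part u u = 0"
  by (simp add: orth_part_def ip_unit)

lemma ip_orth_part: "ip u (orth_part u x) = 0"
proof -
  have "ip x u = ip (smul (ip x u) u) u + ip (orth_part u x) u"
    using ip_add_left orth_part_decomp[of x u] by metis
  then have "ip (orth_part u x) u = 0"
    by (simp add: ip_scale_left ip_unit)
  then show ?thesis
    using norm_ip_commute[of u "orth_part u x"] by simp
qed

lemma norm_decomp: "(norm x)\<^sup>2 = (norm (ip x u))\<^sup>2 + (norm (orth_part u x))\<^sup>2"
  using Pythagoras[of "smul (ip x u) u" "orth_part u x"]
  by (simp add: ip_scale_left ip_orth_part norm_scale unit flip: orth_part_decomp)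

lemma norm_ip_unit_le: "norm (ip x u) \<le> norm x"
  by (rule power2_le_imp_le) (use norm_decomp[of x] in auto)

lemma norm_orth_part_le: "norm (orth_part u x) \<le> norm x"
  by (rule power2_le_imp_le) (use norm_decomp[of x] in auto)

text \<open>
  On the plane spanned by \<open>u\<close> and a unit vector orthogonal to it, the norm of a functional is the
  Euclidean norm of its coefficients; a functional of norm at most \<open>1\<close> that nearly attains \<open>1\<close>
  at \<open>u\<close> has therefore little room left on the orthogonal complement.
\<close>

lemma norm_functional_orthogonal_le:
  fixes f :: "'a \<Rightarrow> 'k"
  assumes add: "\<And>x y. f (x + y) = f x + f y"
    and scale: "\<And>c x. f (smul c x) = c * f x"
    and bound: "\<And>x. norm (f x) \<le> norm x"
    and orth: "ip u w = 0"
    and t: "0 \<le> t" "t \<le> 1" "norm (f u) \<ge> 1 - t\<^sup>2 / 2"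
  shows "norm (f w) \<le> t * norm w"
proof -
  let ?b = "norm (f u)" and ?c = "norm (f w)"
  let ?S = "?b\<^sup>2 * (norm w)\<^sup>2 + ?c\<^sup>2"
  \<comment> \<open>Testing \<open>f\<close> on \<open>?s u + ?t w\<close> gives the equality case of Cauchy--Schwarz for the coefficients;
     dividing by \<open>f u\<close> and \<open>f w\<close> replaces their complex conjugates.\<close>
  let ?s = "of_real (?b\<^sup>2 * (norm w)\<^sup>2) / f u" and ?t = "of_real (?c\<^sup>2) / f w"
  have "?s * f u = of_real (?b\<^sup>2 * (norm w)\<^sup>2)" "?t * f w = of_real (?c\<^sup>2)"
    by (cases "f u = 0"; cases "f w = 0"; simp)+
  then have val: "f (smul ?s u + smul ?t w) = of_real ?S"
    by (simp only: add scale of_real_add)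
  have ns: "norm ?s = ?b * (norm w)\<^sup>2" and nt: "norm ?t = ?c"
    by (cases "f u = 0"; cases "f w = 0"; simp add: norm_divide norm_mult norm_power power2_eq_square)+
  have "ip u (smul ?t w) = 0"
    using norm_ip_commute[of u "smul ?t w"] norm_ip_commute[of u w] orth
    by (simp add: ip_scale_left)
  then have "(norm (smul ?s u + smul ?t w))\<^sup>2 = (norm ?s)\<^sup>2 + (norm ?t)\<^sup>2 * (norm w)\<^sup>2"
    by (subst Pythagoras) (simp_all only: ip_scale_left norm_scale unit mult_zero_right
        mult_1_right power_mult_distrib)
  also have "\<dots> = (norm w)\<^sup>2 * ?S"
    unfolding ns nt by (simp add: power2_eq_square algebra_simps)
  finally have "?S\<^sup>2 \<le> (norm w)\<^sup>2 * ?S"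
    using power_mono[OF bound[of "smul ?s u + smul ?t w"], of 2] unfolding val
    by (simp only: norm_ge_zero norm_of_real power2_abs)
  then have S: "?S \<le> (norm w)\<^sup>2"
    by (cases "?S > 0") (simp_all only: power2_eq_square[of ?S] mult_le_cancel_right,
        auto simp: not_less intro: order_trans)
  have "t\<^sup>2 \<le> 1"
    using t by (simp add: power_le_one)
  then have "(1 - t\<^sup>2 / 2)\<^sup>2 \<le> ?b\<^sup>2"
    using t(3) by (intro power_mono) auto
  moreover have "(1 - t\<^sup>2 / 2)\<^sup>2 \<ge> 1 - t\<^sup>2"
    by (simp add: power2_diff)
  ultimately have "(1 - t\<^sup>2) * (norm w)\<^sup>2 \<le> ?b\<^sup>2 * (norm w)\<^sup>2"
    by (intro mult_right_mono) auto
  with S have "?c\<^sup>2 \<le> (t * norm w)\<^sup>2"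
    by (simp add: algebra_simps)
  then show ?thesis
    by (rule power2_le_imp_le) (use t in auto)
qed

end

end

section \<open>Bilinear forms on Hilbert spaces\<close>

text \<open>
  The new form is block diagonal, and its norm is at most \<open>1\<close> by the Cauchy--Schwarz inequality for
  the pairs of norms of the two components of \<open>x\<close> and of \<open>y\<close>.
\<close>

lemma norm_attaining_form_near:
  fixes b :: "'h1::banach \<Rightarrow> 'h2::banach \<Rightarrow> 'k::real_or_complex"
  assumes "hilbert_space_over smul1 ip1" "hilbert_space_over smul2 ip2"
    and b: "bounded_bilinear_over smul1 smul2 (*) b"
    and b_le: "\<And>x y. norm (b x y) \<le> norm x * norm y"
    and x0: "norm x0 = 1" and y0: "norm y0 = 1"
    and t: "0 < t" "t \<le> 1" "norm (b x0 y0) \<ge> 1 - t\<^sup>2 / 2"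
  obtains a where "bounded_bilinear_over smul1 smul2 (*) a"
    and "\<And>x y. norm (a x y) \<le> norm x * norm y"
    and "norm (a x0 y0) = 1"
    and "\<And>x y. norm (a x y - b x y) \<le> 3 * t * (norm x * norm y)"
proof -
  interpret H1: hilbert_space_over smul1 ip1 by fact
  interpret H2: hilbert_space_over smul2 ip2 by fact
  interpret b: bounded_bilinear b
    using b by (simp add: bounded_bilinear_over_def)
  have b_scale: "b (smul1 c x) y = c * b x y" "b x (smul2 c y) = c * b x y" for c x y
    using b by (simp_all add: bounded_bilinear_over_def)
  define \<beta> where "\<beta> = b x0 y0"
  define P where "P = H1.orth_part x0"
  define Q where "Q = H2.orth_part y0"
  define a where "a x y = sgn \<beta> * ip1 x x0 * ip2 y y0 + b (P x) (Q y)" for x y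
  have "t\<^sup>2 \<le> 1" "t\<^sup>2 \<le> t"
    using t power_le_one[of t 2] by (auto simp: power2_eq_square mult_left_le)
  then have "\<beta> \<noteq> 0"
    using t by (auto simp: \<beta>_def)
  then have sgn: "norm (sgn \<beta>) = 1"
    by (simp add: norm_sgn)
  have ip_le: "norm (ip1 x x0) \<le> norm x" "norm (ip2 y y0) \<le> norm y"
    and PQ_le: "norm (P x) \<le> norm x" "norm (Q y) \<le> norm y" for x y
    using H1.norm_ip_unit_le[OF x0] H2.norm_ip_unit_le[OF y0]
      H1.norm_orth_part_le[OF x0] H2.norm_orth_part_le[OF y0] by (auto simp: P_def Q_def)
  have a_le: "norm (a x y) \<le> norm x * norm y" for x y
  proof -
    have "norm (a x y) \<le> norm (ip1 x x0) * norm (ip2 y y0) + norm (P x) * norm (Q y)"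
      unfolding a_def using b_le[of "P x" "Q y"]
      by (intro norm_triangle_le) (simp add: norm_mult sgn)
    also have "\<dots> \<le> norm x * norm y"
    proof (rule power2_le_imp_le)
      have "(norm (ip1 x x0) * norm (ip2 y y0) + norm (P x) * norm (Q y))\<^sup>2
          \<le> ((norm (ip1 x x0))\<^sup>2 + (norm (P x))\<^sup>2) * ((norm (ip2 y y0))\<^sup>2 + (norm (Q y))\<^sup>2)"
        using zero_le_power2[of "norm (ip1 x x0) * norm (Q y) - norm (P x) * norm (ip2 y y0)"]
        by (simp add: power2_eq_square algebra_simps)
      also have "\<dots> = (norm x * norm y)\<^sup>2"
        by (simp add: P_def Q_def power_mult_distrib H1.norm_decomp[OF x0, of x]
            H2.norm_decomp[OF y0, of y])
      finally show "(norm (ip1 x x0) * norm (ip2 y y0) + norm (P x) * norm (Q y))\<^sup>2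
          \<le> (norm x * norm y)\<^sup>2" .
    qed simp
    finally show ?thesis .
  qed
  have row: "norm (b x0 (Q y)) \<le> t * norm y" for y
  proof -
    have "norm (b x0 (Q y)) \<le> t * norm (Q y)"
      unfolding Q_def using b_le[of x0] t x0
      by (intro H2.norm_functional_orthogonal_le[OF y0, where f = "b x0"] H2.ip_orth_part[OF y0])
        (auto simp: b.add_right b_scale)
    also have "\<dots> \<le> t * norm y"
      using t PQ_le by simp
    finally show ?thesis .
  qed
  have col: "norm (b (P x) y0) \<le> t * norm x" for x
  proof -
    have "norm (b (P x) y0) \<le> t * norm (P x)"
      unfolding P_def using b_le[of _ y0] t y0
      by (intro H1.norm_functional_orthogonal_le[OF x0, where f = "\<lambda>x. b x y0"]
          H1.ip_orth_part[OF x0])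
        (auto simp: b.add_left b_scale)
    also have "\<dots> \<le> t * norm x"
      using t PQ_le by simp
    finally show ?thesis .
  qed
  have corner: "norm (sgn \<beta> - \<beta>) \<le> t"
  proof -
    have "sgn \<beta> - \<beta> = (1 - norm \<beta>) *\<^sub>R sgn \<beta>"
      using \<open>\<beta> \<noteq> 0\<close> by (simp add: sgn_div_norm algebra_simps)
    moreover have "\<bar>1 - norm \<beta>\<bar> \<le> t"
      using t(3) b_le[of x0 y0] \<open>t\<^sup>2 \<le> t\<close> t(1) x0 y0 by (auto simp: \<beta>_def)
    ultimately show ?thesis
      by (simp add: sgn)
  qed
  have near: "norm (a x y - b x y) \<le> 3 * t * (norm x * norm y)" for x y
  proof -
    let ?p = "ip1 x x0" and ?q = "ip2 y y0"
    have "b x y = b (smul1 ?p x0 + P x) (smul2 ?q y0 + Q y)"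
      unfolding P_def Q_def by (simp flip: H1.orth_part_decomp H2.orth_part_decomp)
    then have "a x y - b x y = (sgn \<beta> - \<beta>) * ?p * ?q - ?p * b x0 (Q y) - ?q * b (P x) y0"
      by (simp add: a_def b.add_left b.add_right b_scale \<beta>_def algebra_simps)
    also have "norm \<dots> \<le> norm ((sgn \<beta> - \<beta>) * ?p * ?q) + norm (?p * b x0 (Q y))
        + norm (?q * b (P x) y0)"
      by (meson add_mono norm_triangle_ineq4 order_refl order_trans)
    also have "\<dots> \<le> t * norm x * norm y + norm x * (t * norm y) + norm y * (t * norm x)"
      unfolding norm_mult using t
      by (intro add_mono mult_mono corner row col ip_le) auto
    finally show ?thesis
      by (simp add: algebra_simps)
  qed
  show thesis
  proof
    show "bounded_bilinear_over smul1 smul2 (*) a"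
      by (rule bounded_bilinear_overI[where C = 1])
        (use a_le in \<open>auto simp: normed_space_over_mult H1.normed_space_over_axioms
          H2.normed_space_over_axioms a_def P_def Q_def H1.ip_add_left H2.ip_add_left
          H1.ip_scale_left H2.ip_scale_left H1.orth_part_add H2.orth_part_add H1.orth_part_scale
          H2.orth_part_scale b.add_left b.add_right b_scale algebra_simps\<close>)
    show "norm (a x0 y0) = 1"
      by (simp add: a_def P_def Q_def H1.orth_part_self[OF x0] H1.ip_unit[OF x0]
          H2.ip_unit[OF y0] sgn b.zero_left)
  qed (fact a_le near)+
qed

section \<open>Property beta\<close>

lemma property_beta_functional:
  assumes "property_beta smulZ \<rho> I z zs" "i \<in> I"
  shows "bounded_linear (zs i)" "zs i (smulZ c v) = c * zs i v" "norm (zs i v) \<le> norm v"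
proof -
  have "zs i \<in> dual_sphere smulZ"
    using assms by (auto simp: property_beta_def)
  then show lin: "bounded_linear (zs i)" "zs i (smulZ c v) = c * zs i v"
    and "norm (zs i v) \<le> norm v"
    using onorm[of "zs i" v] by (auto simp: dual_sphere_def)
qed

lemma property_beta_norm_le:
  assumes "property_beta smulZ \<rho> I z zs" "0 \<le> C" "\<And>i. i \<in> I \<Longrightarrow> norm (zs i v) \<le> C"
  shows "norm v \<le> C"
proof -
  have "ennreal (norm v) = (SUP i\<in>I. ennreal (norm (zs i v)))"
    using assms(1) by (simp add: property_beta_def)
  also have "\<dots> \<le> ennreal C"
    using assms(3) by (intro SUP_least ennreal_leI)
  finally show ?thesis
    using \<open>0 \<le> C\<close> by simp
qed

text \<open>
  Passage from forms to \<open>Z\<close>-valued maps.  The correction of \<open>B\<close> is a multiple of \<open>z i\<close>, which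
  the functionals other than \<open>zs i\<close> see only with the factor \<open>\<rho>\<close>.  The factor \<open>1 + \<delta>\<close> in the
  target \<open>(1 + \<delta>) F\<close> is the margin that absorbs what they see.
\<close>

lemma property_beta_lift:
  fixes B :: "'x::real_normed_vector \<Rightarrow> 'y::real_normed_vector \<Rightarrow> 'z::real_normed_vector"
    and smulZ :: "'k::real_or_complex \<Rightarrow> 'z \<Rightarrow> 'z"
  assumes sp: "normed_space_over smulX" "normed_space_over smulY" "normed_space_over smulZ"
    and pb: "property_beta smulZ \<rho> I z zs" and i: "i \<in> I"
    and B: "bounded_bilinear_over smulX smulY smulZ B"
    and B_le: "\<And>x y. norm (B x y) \<le> norm x * norm y"
    and F: "bounded_bilinear_over smulX smulY (*) F"
    and F_le: "\<And>x y. norm (F x y) \<le> norm x * norm y"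
    and attain: "norm x0 = 1" "norm y0 = 1" "norm (F x0 y0) = 1"
    and "0 < \<delta>"
    and near: "\<And>x y. norm (F x y - zs i (B x y)) \<le> (1 - \<rho>) * \<delta> * (norm x * norm y)"
  obtains A where "bounded_bilinear_over smulX smulY smulZ A" "bilinear_norm A = 1"
    and "norm (A x0 y0) = 1" "bilinear_norm (\<lambda>x y. A x y - B x y) \<le> 3 * \<delta>"
proof -
  interpret Z: normed_space_over smulZ by fact
  interpret B: bounded_bilinear B
    using B by (simp add: bounded_bilinear_over_def)
  interpret F: bounded_bilinear F
    using F by (simp add: bounded_bilinear_over_def)
  have B_scale: "B (smulX c x) y = smulZ c (B x y)" "B x (smulY c y) = smulZ c (B x y)"
    and F_scale: "F (smulX c x) y = c * F x y" "F x (smulY c y) = c * F x y" for c x y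
    using B F by (simp_all add: bounded_bilinear_over_def)
  note zs = property_beta_functional[OF pb]
  note zs_lin = linear_simps[OF zs(1)]
  have \<rho>: "0 \<le> \<rho>" "\<rho> < 1" and zi: "norm (z i) = 1" "zs i (z i) = 1"
    and zj: "\<And>j. j \<in> I \<Longrightarrow> j \<noteq> i \<Longrightarrow> norm (zs j (z i)) \<le> \<rho>"
    using pb i by (auto simp: property_beta_def image_subset_iff)
  define D where "D x y = of_real (1 + \<delta>) * F x y - zs i (B x y)" for x y
  define A where "A x y = (1 / (1 + \<delta>)) *\<^sub>R (B x y + smulZ (D x y) (z i))" for x y
  have D_le: "norm (D x y) \<le> (\<delta> + (1 - \<rho>) * \<delta>) * (norm x * norm y)" for x y
  proof -
    have "D x y = of_real \<delta> * F x y + (F x y - zs i (B x y))"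
      by (simp add: D_def algebra_simps)
    also have "norm \<dots> \<le> \<delta> * (norm x * norm y) + (1 - \<rho>) * \<delta> * (norm x * norm y)"
      using F_le[of x y] near[of x y] \<open>0 < \<delta>\<close>
      by (intro norm_triangle_le add_mono) (auto simp: norm_mult)
    finally show ?thesis by (simp add: algebra_simps)
  qed
  have zs_A: "zs j (A x y) = (1 / (1 + \<delta>)) *\<^sub>R (zs j (B x y) + D x y * zs j (z i))"
    if "j \<in> I" for j x y
    using that by (simp add: A_def zs_lin zs(2))
  have zs_i: "zs i (A x y) = F x y" for x y
  proof -
    have "zs i (A x y) = (1 / (1 + \<delta>)) *\<^sub>R ((1 + \<delta>) *\<^sub>R F x y)"
      unfolding zs_A[OF i] by (simp add: zi D_def scaleR_conv_of_real)
    then show ?thesis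
      using \<open>0 < \<delta>\<close> by simp
  qed
  have A_le: "norm (A x y) \<le> norm x * norm y" for x y
  proof (rule property_beta_norm_le[OF pb])
    fix j assume j: "j \<in> I"
    show "norm (zs j (A x y)) \<le> norm x * norm y"
    proof (cases "j = i")
      case True
      then show ?thesis using zs_i F_le by simp
    next
      case False
      let ?n = "norm x * norm y"
      have "norm (zs j (B x y) + D x y * zs j (z i)) \<le> ?n + (\<delta> + (1 - \<rho>) * \<delta>) * ?n * \<rho>"
        unfolding norm_mult using \<open>0 < \<delta>\<close> \<rho>
        by (intro norm_triangle_le add_mono order_trans[OF zs(3)[OF j] B_le])
          (auto simp: norm_mult intro!: mult_mono D_le zj j False)
      \<comment> \<open>The tolerance \<open>(1 - \<rho>) \<delta>\<close> makes the total displacement \<open>(2 - \<rho>) \<delta>\<close>, and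
         \<open>\<rho> (2 - \<rho>) = 1 - (1 - \<rho>)^2 \<le> 1\<close>.\<close>
      also have "\<dots> = (1 + \<delta> * (1 - (1 - \<rho>)\<^sup>2)) * ?n"
        by (simp add: power2_eq_square algebra_simps)
      also have "\<dots> \<le> (1 + \<delta>) * ?n"
        using \<open>0 < \<delta>\<close> by (intro mult_right_mono) (auto simp: mult_left_le)
      finally show ?thesis
        using \<open>0 < \<delta>\<close> j by (simp add: zs_A divide_simps mult.commute)
    qed
  qed simp
  have A: "bounded_bilinear_over smulX smulY smulZ A"
    by (rule bounded_bilinear_overI[OF sp, where C = 1])
      (use A_le in \<open>auto simp: A_def D_def B.add_left B.add_right F.add_left F.add_right B_scale
        F_scale zs(2)[OF i] zs_lin[OF i] Z.scale_scaleR Z.scale_left_distrib Z.scale_right_distrib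
        Z.scale_left_diff_distrib Z.scale_right_diff_distrib algebra_simps\<close>)
  have at: "norm (A x0 y0) = 1"
    using zs(3)[OF i, of "A x0 y0"] zs_i[of x0 y0] A_le[of x0 y0] attain by simp
  have "bilinear_norm A \<le> 1"
    using A_le by (intro bilinear_norm_le) auto
  moreover have "1 \<le> bilinear_norm A"
    using norm_le_bilinear_norm[of A x0 y0] A attain at by (simp add: bounded_bilinear_over_def)
  ultimately have nA: "bilinear_norm A = 1" by simp
  have diff: "norm (A x y - B x y) \<le> 3 * \<delta> * (norm x * norm y)" for x y
  proof -
    let ?n = "norm x * norm y"
    have "(1 + \<delta>) *\<^sub>R A x y = B x y + smulZ (D x y) (z i)"
      using \<open>0 < \<delta>\<close> by (simp add: A_def)
    then have "A x y - B x y = smulZ (D x y) (z i) - \<delta> *\<^sub>R A x y"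
      by (simp add: algebra_simps)
    also have "norm \<dots> \<le> norm (D x y) + \<delta> * norm (A x y)"
      using \<open>0 < \<delta>\<close> norm_triangle_ineq4[of "smulZ (D x y) (z i)" "\<delta> *\<^sub>R A x y"]
      by (simp add: Z.norm_scale zi)
    also have "\<dots> \<le> (\<delta> + (1 - \<rho>) * \<delta>) * ?n + \<delta> * ?n"
      using \<open>0 < \<delta>\<close> by (intro add_mono D_le mult_left_mono A_le) auto
    also have "\<dots> \<le> 3 * \<delta> * ?n"
      using \<open>0 < \<delta>\<close> \<rho> by (simp add: algebra_simps)
    finally show ?thesis .
  qed
  show thesis
    by (rule that[OF A nA at]) (use \<open>0 < \<delta>\<close> diff in \<open>intro bilinear_norm_le; simp\<close>)
qed

section \<open>The Bishop--Phelps--Bollobas point property\<close>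

theorem corollary3p4:
  fixes smul1 :: "'k::real_or_complex \<Rightarrow> 'h1::banach \<Rightarrow> 'h1"
    and smul2 :: "'k \<Rightarrow> 'h2::banach \<Rightarrow> 'h2"
    and smulZ :: "'k \<Rightarrow> 'z::banach \<Rightarrow> 'z"
    and ip1 :: "'h1 \<Rightarrow> 'h1 \<Rightarrow> 'k"
    and ip2 :: "'h2 \<Rightarrow> 'h2 \<Rightarrow> 'k"
    and \<rho> :: real and I :: "'i set" and z :: "'i \<Rightarrow> 'z" and zs :: "'i \<Rightarrow> 'z \<Rightarrow> 'k"
  assumes "hilbert_space_over smul1 ip1"
    and "hilbert_space_over smul2 ip2"
    and "banach_space_over smulZ"
    and "property_beta smulZ \<rho> I z zs"
  shows "BPBpp_bilinear smul1 smul2 smulZ"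
proof -
  interpret H1: hilbert_space_over smul1 ip1 by fact
  interpret H2: hilbert_space_over smul2 ip2 by fact
  interpret Z: banach_space_over smulZ by fact
  note sp = H1.normed_space_over_axioms H2.normed_space_over_axioms Z.normed_space_over_axioms
  note pb = assms(4)
  have \<rho>: "0 \<le> \<rho>" "\<rho> < 1"
    using pb by (auto simp: property_beta_def)
  show ?thesis
    unfolding BPBpp_bilinear_def
  proof (intro allI impI)
    fix \<epsilon> :: real assume "\<epsilon> > 0"
    \<comment> \<open>\<open>3 \<delta> < \<epsilon>\<close> is the final error, and \<open>3 t \<le> (1 - \<rho>) \<delta>\<close> is the error allowed for the form.\<close>
    define \<delta> where "\<delta> = min 1 (\<epsilon> / 6)"
    define t where "t = (1 - \<rho>) * \<delta> / 3"
    have \<delta>: "0 < \<delta>" "\<delta> \<le> 1" "3 * \<delta> < \<epsilon>"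
      using \<open>\<epsilon> > 0\<close> by (auto simp: \<delta>_def min_def)
    have "(1 - \<rho>) * \<delta> \<le> 1"
      using \<rho> \<delta> by (intro mult_le_one) auto
    then have t: "0 < t" "t \<le> 1"
      using \<rho> \<delta> by (auto simp: t_def)
    show "\<exists>\<eta>>0. \<forall>B x0 y0.
        bounded_bilinear_over smul1 smul2 smulZ B \<longrightarrow> bilinear_norm B = 1 \<longrightarrow>
        x0 \<in> sphere 0 1 \<longrightarrow> y0 \<in> sphere 0 1 \<longrightarrow> norm (B x0 y0) > 1 - \<eta> \<longrightarrow>
        (\<exists>A. bounded_bilinear_over smul1 smul2 smulZ A \<and> bilinear_norm A = 1 \<and>
          norm (A x0 y0) = 1 \<and> bilinear_norm (\<lambda>x y. A x y - B x y) < \<epsilon>)"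
    proof (intro exI[of _ "t\<^sup>2 / 2"] conjI allI impI)
      show "t\<^sup>2 / 2 > 0" using t by simp
    next
      fix B x0 y0
      assume B: "bounded_bilinear_over smul1 smul2 smulZ B" and nB: "bilinear_norm B = 1"
        and "x0 \<in> sphere 0 1" "y0 \<in> sphere 0 1" and big: "norm (B x0 y0) > 1 - t\<^sup>2 / 2"
      then have x0: "norm x0 = 1" and y0: "norm y0 = 1" by auto
      interpret B: bounded_bilinear B
        using B by (simp add: bounded_bilinear_over_def)
      have B_le: "norm (B x y) \<le> norm x * norm y" for x y
        using norm_le_bilinear_norm[OF B.bounded_bilinear_axioms, of x y] nB by simp
      have "0 \<le> 1 - t\<^sup>2 / 2"
        using power_le_one[of t 2] t by simp
      then obtain i where i: "i \<in> I" and bigi: "norm (zs i (B x0 y0)) > 1 - t\<^sup>2 / 2"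
        using property_beta_norm_le[OF pb, of "1 - t\<^sup>2 / 2" "B x0 y0"] big
        by (meson not_le)
      note zs = property_beta_functional[OF pb i]
      have zsB_le: "norm (zs i (B x y)) \<le> norm x * norm y" for x y
        using zs(3) B_le by (rule order_trans)
      have "bounded_bilinear_over smul1 smul2 (*) (\<lambda>x y. zs i (B x y))"
        by (rule bounded_bilinear_overI[OF sp(1,2) normed_space_over_mult, where C = 1])
          (use B zsB_le in \<open>auto simp: bounded_bilinear_over_def B.add_left B.add_right
            linear_simps[OF zs(1)] zs(2)\<close>)
      then obtain F where F: "bounded_bilinear_over smul1 smul2 (*) F"
        "\<And>x y. norm (F x y) \<le> norm x * norm y" "norm (F x0 y0) = 1"
        and near: "\<And>x y. norm (F x y - zs i (B x y)) \<le> 3 * t * (norm x * norm y)"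
        using norm_attaining_form_near[OF assms(1,2) _ zsB_le x0 y0 t] bigi
        by (metis less_imp_le)
      have "3 * t = (1 - \<rho>) * \<delta>"
        by (simp add: t_def)
      then obtain A where "bounded_bilinear_over smul1 smul2 smulZ A" "bilinear_norm A = 1"
        "norm (A x0 y0) = 1" "bilinear_norm (\<lambda>x y. A x y - B x y) \<le> 3 * \<delta>"
        using property_beta_lift[OF sp pb i B B_le F(1,2) x0 y0 F(3) \<delta>(1)] near by metis
      with \<delta> show "\<exists>A. bounded_bilinear_over smul1 smul2 smulZ A \<and> bilinear_norm A = 1 \<and>
          norm (A x0 y0) = 1 \<and> bilinear_norm (\<lambda>x y. A x y - B x y) < \<epsilon>"
        by (meson le_less_trans)
    qed
  qed
qed

end
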